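(* Let $\Delta t,\Delta x>0$, let $\lambda=\frac{\Delta t}{\Delta x}$ be the Courant number, and let $A=(a_{ij})\in\mathbb{R}^{r\times r}$ be the coefficient matrix of the underlying $r$-stage Runge--Kutta method. Consider the diamond scheme for the one-dimensional nonlinear wave equation $u_{tt}-u_{xx}=f(u)$ in its multi-Hamiltonian form $K\mathbf{z}_t+L\mathbf{z}_x=\nabla S(\mathbf{z})$, where $\mathbf{z}=(u,v,w)\in\mathbb{R}^3$, $$K=\begin{pmatrix}0&-1&0\\1&0&0\\0&0&0\end{pmatrix},\quad L=\begin{pmatrix}0&0&1\\0&0&0\\-1&0&0\end{pmatrix},\quad S(\mathbf{z})=-V(u)+\tfrac12 v^2-\tfrac12 w^2,\quad f(u)=-V'(u).$$ Assume that - $f:\mathbb{R}\to\mathbb{R}$ is Lipschitz with constant $\Lambda$; - the matrix $$B=(1-\lambda^2)(I\otimes A^{-2})+2(1+\lambda^2)(A^{-1}\otimes A^{-1})+(1-\lambda^2)(A^{-2}\otimes I)\in\mathbb{R}^{r^2\times r^2}$$ exists (i.e. $A$ is invertible) and is invertible; - $(\Delta t)^2<\dfrac{1}{\Lambda\,\|B^{-1}\|_\infty}$ (no restriction if $\Lambda=0$). Then the stage equations of the diamond scheme on a single diamond are solvable: for all given edge data $\tilde{\mathbf{z}}_\ell^j,\tilde{\mathbf{z}}^{\mathrm b}_i\in\mathbb{R}^3$ ($i,j=1,\dots,r$), there exist $\mathbf{Z}_i^j,\mathbf{X}_i^j,\mathbf{T}_i^j\in\mathbb{R}^3$ ($i,j=1,\dots,r$)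 satisfying, for all $i,j\in\{1,\dots,r\}$, $$\mathbf{Z}_i^j=\tilde{\mathbf{z}}_\ell^j+\sum_{k=1}^r a_{ik}\mathbf{X}_k^j,\qquad \mathbf{Z}_i^j=\tilde{\mathbf{z}}^{\mathrm b}_i+\sum_{k=1}^r a_{jk}\mathbf{T}_i^k,\qquad \nabla S(\mathbf{Z}_i^j)=\tilde K\mathbf{T}_i^j+\tilde L\mathbf{X}_i^j,$$ where $\tilde K=\frac1{\Delta t}K-\frac1{\Delta x}L$ and $\tilde L=\frac1{\Delta t}K+\frac1{\Delta x}L$; thus the diamond scheme is well defined.
   Context: The diamond scheme divides space-time into diamonds of width $\Delta x$ and height $\Delta t$; each diamond is mapped linearly to the unit square by $\tilde x=\frac{x}{\Delta x}+\frac{t}{\Delta t}$, $\tilde t=-\frac{x}{\Delta x}+\frac{t}{\Delta t}$, which turns the PDE into $\tilde K\tilde{\mathbf z}_{\tilde t}+\tilde L\tilde{\mathbf z}_{\tilde x}=\nabla S(\tilde{\mathbf z})$. On the square, the left-edge values $\tilde{\mathbf z}_\ell^j$ and bottom-edge values $\tilde{\mathbf z}^{\mathrm b}_i$ are known. One solves the stage equations displayed in the claim for the internal stages $\mathbf Z_i^j$ and the stage derivatives $\mathbf X_i^j,\mathbf T_i^j$, and then computes the right- and top-edge values by $\tilde{\mathbf z}_{\mathrm r}^i=\tilde{\mathbf z}_\ell^i+\sum_k b_k\mathbf X_k^i$, $\tilde{\mathbf z}^{\mathrm t}_i=\tilde{\mathbf z}^{\mathrm b}_i+\sum_k b_k\mathbf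 T_i^k$, where $b$ is the weight vector of the Runge--Kutta method. Here $V:\mathbb R\to\mathbb R$ is differentiable, $I$ is the $r\times r$ identity, $\otimes$ is the Kronecker product, and $\|\cdot\|_\infty$ is the matrix norm induced by the maximum norm. *)

theory Defs
  imports "HOL-Analysis.Analysis"
begin

definition kronecker :: "real^'n^'m \<Rightarrow> real^'q^'p \<Rightarrow> real^('n \<times> 'q)^('m \<times> 'p)"
    (infixl "\<otimes>" 75) where
  "M \<otimes> N = (\<chi> i j. M $ fst i $ fst j * N $ snd i $ snd j)"

text \<open>The operator norm induced by \<^const>\<open>infnorm\<close>, in the same form as \<^const>\<open>onorm\<close>;
  the quotient at \<open>x = 0\<close> is \<open>0\<close>.\<close>

definition mat_infnorm :: "real^'n^'m \<Rightarrow> real" where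
  "mat_infnorm M = (SUP x. infnorm (M *v x) / infnorm x)"

text \<open>The coefficients of the equation after the change of variables \<open>x' = x / dx + t / dt\<close>,
  \<open>t' = - x / dx + t / dt\<close>, which maps a diamond to the unit square.\<close>

definition K_tilde :: "real \<Rightarrow> real \<Rightarrow> real^'n^'n \<Rightarrow> real^'n^'n \<Rightarrow> real^'n^'n" where
  "K_tilde dt dx K L = (1 / dt) *\<^sub>R K - (1 / dx) *\<^sub>R L"

definition L_tilde :: "real \<Rightarrow> real \<Rightarrow> real^'n^'n \<Rightarrow> real^'n^'n \<Rightarrow> real^'n^'n" where
  "L_tilde dt dx K L = (1 / dt) *\<^sub>R K + (1 / dx) *\<^sub>R L"

text \<open>The stage equations on one diamond for \<open>K z\<^sub>t + L z\<^sub>x = \<nabla>S(z)\<close>. The stage indices range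
  over the type \<open>'r\<close>, so \<open>CARD('r)\<close> is the number of Runge--Kutta stages; \<open>Z i j\<close> carries the
  index \<open>i\<close> of the \<open>x\<close>-direction first and the index \<open>j\<close> of the \<open>t\<close>-direction second
  (both in the coordinates of the unit square). The last equation is \<open>\<nabla>S(Z i j) = \<dots>\<close>.\<close>

definition diamond_stage_equations ::
  "real^'n^'n \<Rightarrow> real^'n^'n \<Rightarrow> (real^'n \<Rightarrow> real) \<Rightarrow> real \<Rightarrow> real \<Rightarrow> real^'r^'r \<Rightarrow>
   ('r \<Rightarrow> real^'n) \<Rightarrow> ('r \<Rightarrow> real^'n) \<Rightarrow>
   ('r \<Rightarrow> 'r \<Rightarrow> real^'n) \<Rightarrow> ('r \<Rightarrow> 'r \<Rightarrow> real^'n) \<Rightarrow> ('r \<Rightarrow> 'r \<Rightarrow> real^'n) \<Rightarrow> bool" where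
  "diamond_stage_equations K L S dt dx A zl zb Z X T \<longleftrightarrow>
     (\<forall>i j.
        Z i j = zl j + (\<Sum>k\<in>UNIV. A $ i $ k *\<^sub>R X k j) \<and>
        Z i j = zb i + (\<Sum>k\<in>UNIV. A $ j $ k *\<^sub>R T i k) \<and>
        GDERIV S (Z i j) :> K_tilde dt dx K L *v T i j + L_tilde dt dx K L *v X i j)"

text \<open>The nonlinear wave equation with \<open>z = (u, v, w)\<close>.\<close>

definition wave_K :: "real^3^3" where
  "wave_K = vector [vector [0, -1, 0], vector [1, 0, 0], vector [0, 0, 0]]"

definition wave_L :: "real^3^3" where
  "wave_L = vector [vector [0, 0, 1], vector [0, 0, 0], vector [-1, 0, 0]]"

definition wave_S :: "(real \<Rightarrow> real) \<Rightarrow> real^3 \<Rightarrow> real" where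
  "wave_S V z = - V (z $ 1) + 1/2 * (z $ 2)\<^sup>2 - 1/2 * (z $ 3)\<^sup>2"

definition wave_B :: "real \<Rightarrow> real^'r^'r \<Rightarrow> real^('r \<times> 'r)^('r \<times> 'r)" where
  "wave_B c A =
     (let A1 = matrix_inv A; A2 = A1 ** A1 in
        (1 - c\<^sup>2) *\<^sub>R (mat 1 \<otimes> A2) + (2 * (1 + c\<^sup>2)) *\<^sub>R (A1 \<otimes> A1) + (1 - c\<^sup>2) *\<^sub>R (A2 \<otimes> mat 1))"

end

theory Submission
  imports Defs
begin

text \<open>Invert \<open>A\<close> to express the stage derivatives through the stages:
  \<open>X = P (Z - z\<^sub>l)\<close> and \<open>T = Q (Z - z\<^sub>b)\<close> componentwise, where
  \<open>P = A\<^sup>-\<^sup>1 \<otimes> I\<close> and \<open>Q = I \<otimes> A\<^sup>-\<^sup>1\<close> commute. The second and third rows of the PDE then give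
  \<open>v\<close> and \<open>w\<close> as affine functions of \<open>u\<close>, and the first row becomes
  \<open>dt\<^sup>2 f(u) = g - B u\<close> with \<open>B = (P + Q)\<^sup>2 - \<lambda>\<^sup>2 (P - Q)\<^sup>2\<close> and a constant \<open>g\<close>. The
  bound on \<open>dt\<close> makes \<open>u \<mapsto> B\<^sup>-\<^sup>1 (g - dt\<^sup>2 f(u))\<close> a contraction in the maximum norm;
  a fixed point \<open>u\<close> is found by minimising the maximum norm of the residual over an
  invariant compact ball.\<close>

text \<open>A contraction in the maximum norm need not contract the Euclidean distance, so Banach's
  theorem for \<open>dist\<close> does not apply directly. Instead, applying \<open>g\<close> to a
  minimiser of the residual shrinks the residual by the factor \<open>q\<close>, so the minimum is
  0.\<close>

lemma infnorm_contraction_has_fixpoint: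
  fixes g :: "'a::euclidean_space \<Rightarrow> 'a"
  assumes "0 \<le> q" "q < 1"
    and contr: "\<And>x y. infnorm (g x - g y) \<le> q * infnorm (x - y)"
  shows "\<exists>x. g x = x"
proof -
  \<comment> \<open>The solution of \<open>R = q * R + infnorm (g 0)\<close>, which makes the ball
    \<open>C\<close> invariant under \<open>g\<close>.\<close>
  define R where "R = infnorm (g 0) / (1 - q)"
  define C where "C = {x::'a. infnorm x \<le> R}"
  have contin: "continuous_on UNIV g"
  proof (rule lipschitz_on_continuous_on)
    have "dist (g x) (g y) \<le> (sqrt DIM('a) * q) * dist x y" for x y
    proof -
      have "norm (g x - g y) \<le> sqrt DIM('a) * infnorm (g x - g y)"
        by (rule norm_le_infnorm)
      also have "\<dots> \<le> sqrt DIM('a) * (q * infnorm (x - y))"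
        using contr by (intro mult_left_mono) auto
      also have "\<dots> \<le> sqrt DIM('a) * (q * norm (x - y))"
        using \<open>0 \<le> q\<close> infnorm_le_norm by (intro mult_left_mono) auto
      finally show ?thesis
        by (simp add: dist_norm mult.assoc)
    qed
    then show "(sqrt DIM('a) * q)-lipschitz_on UNIV g"
      using \<open>0 \<le> q\<close> by (intro lipschitz_onI) auto
  qed
  have "R \<ge> 0"
    using \<open>q < 1\<close> by (simp add: R_def infnorm_pos_le)
  have g_C: "g x \<in> C" if "x \<in> C" for x
  proof -
    have "infnorm (g x) \<le> infnorm (g x - g 0) + infnorm (g 0)"
      using infnorm_triangle[of "g x - g 0" "g 0"] by simp
    also have "\<dots> \<le> q * R + infnorm (g 0)"
      using contr[of x 0] that \<open>0 \<le> q\<close> mult_left_mono[of "infnorm x" R q] by (simp add: C_def)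
    also have "infnorm (g 0) = (1 - q) * R"
      using \<open>q < 1\<close> by (simp add: R_def)
    finally show ?thesis by (simp add: C_def algebra_simps)
  qed
  have "compact C"
    unfolding compact_eq_bounded_closed
  proof
    show "bounded C"
    proof (rule boundedI)
      fix x assume "x \<in> C"
      then show "norm x \<le> sqrt DIM('a) * R"
        using order_trans[OF norm_le_infnorm mult_left_mono[of "infnorm x" R "sqrt DIM('a)"]]
        by (simp add: C_def)
    qed
    show "closed C"
      unfolding C_def by (intro closed_Collect_le continuous_intros continuous_on_infnorm)
  qed
  moreover have "C \<noteq> {}"
    using \<open>R \<ge> 0\<close> by (auto simp: C_def infnorm_0 intro!: exI[of _ 0])
  moreover have "continuous_on C (\<lambda>x. infnorm (g x - x))"
    using contin by (intro continuous_on_infnorm continuous_intros) (auto intro: continuous_on_subset)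
  ultimately obtain x where x: "x \<in> C" "\<And>y. y \<in> C \<Longrightarrow> infnorm (g x - x) \<le> infnorm (g y - y)"
    using continuous_attains_inf[of C "\<lambda>x. infnorm (g x - x)"] by blast
  \<comment> \<open>The minimiser \<open>x\<close> is compared with the competitor
    \<open>g x\<close>, which lies in \<open>C\<close> by invariance.\<close>
  have "infnorm (g x - x) \<le> q * infnorm (g x - x)"
    using x(2)[OF g_C[OF x(1)]] contr[of "g x" x] by linarith
  then have "(1 - q) * infnorm (g x - x) \<le> 0"
    by (simp add: algebra_simps)
  then have "infnorm (g x - x) = 0"
    using \<open>q < 1\<close> infnorm_pos_le[of "g x - x"] by (simp add: mult_le_0_iff)
  then show ?thesis
    by (auto simp: infnorm_eq_0)
qed

lemma matrix_inv_right:
  fixes M :: "'a::semiring_1^'n^'m"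
  assumes "invertible M"
  shows "M ** matrix_inv M = mat 1"
  using someI_ex[OF assms[unfolded invertible_def]] by (simp add: matrix_inv_def)

text \<open>A real supremum bounds its members only if the set is bounded above; here this follows
  from the Euclidean operator bound and the equivalence of the two norms.\<close>

lemma infnorm_matrix_vector_le:
  fixes M :: "real^'n^'m"
  shows "infnorm (M *v x) \<le> mat_infnorm M * infnorm x"
proof (cases "x = 0")
  case True
  then show ?thesis by (simp add: infnorm_0)
next
  case False
  obtain K where K: "\<And>y. norm (M *v y) \<le> norm y * K" "K \<ge> 0"
    using bounded_linear.nonneg_bounded[OF matrix_vector_mul_bounded_linear[of M]] by blast
  have "bdd_above (range (\<lambda>y. infnorm (M *v y) / infnorm y))"
  proof (rule bdd_aboveI2)
    fix y :: "real^'n"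
    have "infnorm (M *v y) \<le> norm y * K"
      using infnorm_le_norm K(1) order_trans by blast
    also have "\<dots> \<le> (sqrt DIM(real^'n) * infnorm y) * K"
      by (rule mult_right_mono[OF norm_le_infnorm K(2)])
    finally show "infnorm (M *v y) / infnorm y \<le> sqrt DIM(real^'n) * K"
      using K(2) infnorm_pos_le[of y]
      by (cases "y = 0") (simp_all add: infnorm_0 divide_le_eq infnorm_pos_lt mult_ac)
  qed
  then have "infnorm (M *v x) / infnorm x \<le> mat_infnorm M"
    unfolding mat_infnorm_def by (intro cSUP_upper) auto
  then show ?thesis
    using False by (simp add: pos_divide_le_eq infnorm_pos_lt)
qed

lemma infnorm_componentwise_lipschitz:
  fixes x y :: "real^'n" and f :: "real \<Rightarrow> real"
  assumes "L-lipschitz_on UNIV f"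
  shows "infnorm ((\<chi> i. f (x $ i)) - (\<chi> i. f (y $ i))) \<le> L * infnorm (x - y)"
  unfolding infnorm_Max[of "(\<chi> i. f (x $ i)) - (\<chi> i. f (y $ i))"]
proof (rule Max.boundedI)
  fix a assume "a \<in> (\<lambda>i. \<bar>((\<chi> i. f (x $ i)) - (\<chi> i. f (y $ i))) \<bullet> i\<bar>) ` Basis"
  then obtain i where "a = \<bar>f (x $ i) - f (y $ i)\<bar>"
    by (auto simp: Basis_vec_def inner_axis)
  also have "\<dots> \<le> L * \<bar>(x - y) $ i\<bar>"
    using lipschitz_onD[OF assms, of "x $ i" "y $ i"] by (simp add: dist_real_def)
  also have "\<dots> \<le> L * infnorm (x - y)"
    using component_le_infnorm_cart lipschitz_on_nonneg[OF assms] by (intro mult_left_mono)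
  finally show "a \<le> L * infnorm (x - y)" .
qed auto

text \<open>The mixed-product rule makes \<open>P\<close> and \<open>Q\<close> commute: both
  products equal the Kronecker product of \<open>matrix_inv A\<close> with itself.\<close>

lemma kronecker_mult:
  "(M \<otimes> N) ** (M' \<otimes> N') = (M ** M') \<otimes> (N ** N')"
  by (simp add: kronecker_def matrix_matrix_mult_def vec_eq_iff sum_product
      sum.cartesian_product UNIV_Times_UNIV[symmetric] case_prod_unfold mult_ac
      del: UNIV_Times_UNIV)

lemma kronecker_mat_1: "mat 1 \<otimes> mat 1 = mat 1"
  by (auto simp: kronecker_def mat_def vec_eq_iff prod_eq_iff)

text \<open>The left Kronecker factor acts on the first index with \<open>j\<close> held fixed,
  which is the shape of the sum in the first stage equation.\<close>

lemma kronecker_mat_1_right_vector: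
  "((M \<otimes> mat 1) *v x) $ (i, j) = (\<Sum>k\<in>UNIV. M $ i $ k * x $ (k, j))"
proof -
  have "((M \<otimes> mat 1) *v x) $ (i, j)
      = (\<Sum>k\<in>UNIV. \<Sum>l\<in>UNIV. M $ i $ k * mat 1 $ j $ l * x $ (k, l))"
    by (simp add: kronecker_def matrix_vector_mult_def sum.cartesian_product case_prod_unfold)
  then show ?thesis
    by (simp add: mat_def if_distrib[of "\<lambda>c. _ * c"] if_distrib[of "\<lambda>c. c * _"] cong: if_cong)
qed

lemma kronecker_mat_1_left_vector:
  "((mat 1 \<otimes> N) *v x) $ (i, j) = (\<Sum>l\<in>UNIV. N $ j $ l * x $ (i, l))"
proof -
  have "((mat 1 \<otimes> N) *v x) $ (i, j)
      = (\<Sum>l\<in>UNIV. \<Sum>k\<in>UNIV. mat 1 $ i $ k * N $ j $ l * x $ (k, l))"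
    by (subst sum.swap)
       (simp add: kronecker_def matrix_vector_mult_def sum.cartesian_product case_prod_unfold)
  then show ?thesis
    by (simp add: mat_def if_distrib[of "\<lambda>c. _ * c"] if_distrib[of "\<lambda>c. c * _"] cong: if_cong)
qed

text \<open>Up to the factors 1/dt and 1/dx, \<open>P + Q\<close> and \<open>P - Q\<close>
  discretise the derivatives in t and x. With \<open>c\<close> = dt/dx, the matrix is therefore the
  discrete wave operator times \<open>dt\<^sup>2\<close>. Expanding the squares uses that
  \<open>P\<close> and \<open>Q\<close> commute.\<close>

lemma wave_B_vector:
  fixes A :: "real^'r^'r"
  defines "P \<equiv> matrix_inv A \<otimes> mat 1" and "Q \<equiv> mat 1 \<otimes> matrix_inv A"
  shows "wave_B c A *v x
    = P *v (P *v x + Q *v x) + Q *v (P *v x + Q *v x)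
      - c\<^sup>2 *\<^sub>R (P *v (P *v x - Q *v x) - Q *v (P *v x - Q *v x))"
proof -
  have "wave_B c A = (1 - c\<^sup>2) *\<^sub>R (Q ** Q) + (2 * (1 + c\<^sup>2)) *\<^sub>R (P ** Q) + (1 - c\<^sup>2) *\<^sub>R (P ** P)"
    by (simp add: wave_B_def Let_def P_def Q_def kronecker_mult)
  then have B: "wave_B c A *v x = (1 - c\<^sup>2) *\<^sub>R (Q *v (Q *v x))
      + (2 * (1 + c\<^sup>2)) *\<^sub>R (P *v (Q *v x)) + (1 - c\<^sup>2) *\<^sub>R (P *v (P *v x))"
    by (simp add: matrix_vector_mult_add_rdistrib matrix_vector_mul_assoc flip: scaleR_matrix_vector_assoc)
  have "Q *v (P *v x) = P *v (Q *v x)"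
    by (simp add: matrix_vector_mul_assoc P_def Q_def kronecker_mult)
  then show ?thesis
    unfolding B
    by (simp add: matrix_vector_right_distrib matrix_vector_mult_diff_distrib vec_eq_iff algebra_simps)
qed

lemma GDERIV_wave_S:
  assumes "V differentiable (at (z $ 1))"
  shows "GDERIV (wave_S V) z :> vector [- deriv V (z $ 1), z $ 2, - (z $ 3)]"
proof -
  have V: "(V has_real_derivative deriv V (z $ 1)) (at (z $ 1))"
    using assms by (simp add: DERIV_deriv_iff_real_differentiable)
  have "((\<lambda>z::real^3. z $ 1) has_derivative (\<lambda>h. h $ 1)) (at z)"
    by (rule bounded_linear_imp_has_derivative) (rule bounded_linear_vec_nth)
  from has_derivative_compose[OF this V[unfolded has_field_derivative_def]]
  have V': "((\<lambda>z. V (z $ 1)) has_derivative (\<lambda>h. deriv V (z $ 1) * h $ 1)) (at z)" .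
  have nth: "((\<lambda>z::real^3. z $ i) has_derivative (\<lambda>h. h $ i)) (at z)" for i
    by (rule bounded_linear_imp_has_derivative) (rule bounded_linear_vec_nth)
  show ?thesis
    unfolding gderiv_def wave_S_def
    by (rule has_derivative_eq_rhs, (rule derivative_intros V' nth)+)
       (simp add: fun_eq_iff inner_vec_def sum_3 algebra_simps)
qed

lemma wave_fixpoint:
  fixes A :: "real^'r^'r" and g :: "real^('r \<times> 'r)"
  assumes lip: "Lip-lipschitz_on UNIV f"
    and inv: "invertible (wave_B lam A)"
    and dt: "Lip \<noteq> 0 \<Longrightarrow> dt\<^sup>2 < 1 / (Lip * mat_infnorm (matrix_inv (wave_B lam A)))"
  shows "\<exists>u. dt\<^sup>2 *\<^sub>R (\<chi> p. f (u $ p)) = g - wave_B lam A *v u"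
proof -
  define B where "B = wave_B lam A"
  define F where "F u = (\<chi> p. f (u $ p))" for u :: "real^('r \<times> 'r)"
  define m where "m = mat_infnorm (matrix_inv B)"
  have "Lip \<ge> 0"
    using lip by (rule lipschitz_on_nonneg)
  have inv_bound: "infnorm (matrix_inv B *v x) \<le> m * infnorm x" for x
    unfolding m_def by (rule infnorm_matrix_vector_le)
  \<comment> \<open>Testing the norm bound on the nonzero all-ones vector yields the sign of
    \<open>m\<close>.\<close>
  have "0 \<le> m * infnorm (1 :: real^('r \<times> 'r))"
    using inv_bound[of 1] infnorm_pos_le order_trans by blast
  moreover have "infnorm (1 :: real^('r \<times> 'r)) > 0"
    by (simp add: infnorm_pos_lt)
  ultimately have "m \<ge> 0"
    by (simp add: zero_le_mult_iff)
  \<comment> \<open>If \<open>Lip * m = 0\<close>, the contraction factor is 0; otherwise the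
    product is positive and the bound on \<open>dt\<close> can be multiplied out.\<close>
  have q: "Lip * m * dt\<^sup>2 < 1"
  proof (cases "Lip * m = 0")
    case False
    then have "Lip * m > 0"
      using \<open>Lip \<ge> 0\<close> \<open>m \<ge> 0\<close> by (simp add: less_le)
    then show ?thesis
      using dt False by (simp add: m_def B_def field_simps)
  qed auto
  have "\<exists>u. matrix_inv B *v (g - dt\<^sup>2 *\<^sub>R F u) = u"
  proof (rule infnorm_contraction_has_fixpoint[OF _ q])
    show "0 \<le> Lip * m * dt\<^sup>2"
      using \<open>Lip \<ge> 0\<close> \<open>m \<ge> 0\<close> by simp
    fix x y
    have "matrix_inv B *v (g - dt\<^sup>2 *\<^sub>R F x) - matrix_inv B *v (g - dt\<^sup>2 *\<^sub>R F y)
        = matrix_inv B *v (dt\<^sup>2 *\<^sub>R (F y - F x))"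
      by (simp add: scaleR_diff_right flip: matrix_vector_mult_diff_distrib)
    then have "infnorm (matrix_inv B *v (g - dt\<^sup>2 *\<^sub>R F x) - matrix_inv B *v (g - dt\<^sup>2 *\<^sub>R F y))
        \<le> m * (dt\<^sup>2 * infnorm (F y - F x))"
      using inv_bound[of "dt\<^sup>2 *\<^sub>R (F y - F x)"] by (simp add: infnorm_mul)
    also have "\<dots> \<le> m * (dt\<^sup>2 * (Lip * infnorm (y - x)))"
      unfolding F_def using \<open>m \<ge> 0\<close> infnorm_componentwise_lipschitz[OF lip]
      by (intro mult_left_mono) auto
    finally show "infnorm (matrix_inv B *v (g - dt\<^sup>2 *\<^sub>R F x) - matrix_inv B *v (g - dt\<^sup>2 *\<^sub>R F y))
        \<le> Lip * m * dt\<^sup>2 * infnorm (x - y)"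
      by (simp add: infnorm_sub mult_ac)
  qed
  then obtain u where u: "matrix_inv B *v (g - dt\<^sup>2 *\<^sub>R F u) = u" ..
  have "B *v u = g - dt\<^sup>2 *\<^sub>R F u"
    using inv by (subst u[symmetric]) (simp add: matrix_vector_mul_assoc matrix_inv_right B_def)
  then show ?thesis
    by (intro exI[of _ u]) (simp add: B_def F_def)
qed

theorem theorem3:
  fixes dt dx lam Lip :: real
    and A :: "real^'r^'r"
    and V f :: "real \<Rightarrow> real"
  assumes "dt > 0" and "dx > 0"
    and "lam = dt / dx"
    and "\<And>u. V differentiable (at u)"
    and "\<And>u. f u = - deriv V u"
    and "Lip-lipschitz_on UNIV f"
    and "invertible A"
    and "invertible (wave_B lam A)"
    and "Lip \<noteq> 0 \<Longrightarrow> dt\<^sup>2 < 1 / (Lip * mat_infnorm (matrix_inv (wave_B lam A)))"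
  shows "\<forall>zl zb :: 'r \<Rightarrow> real^3. \<exists>Z X T.
           diamond_stage_equations wave_K wave_L (wave_S V) dt dx A zl zb Z X T"
proof (intro allI)
  fix zl zb :: "'r \<Rightarrow> real^3"
  \<comment> \<open>Each component of the stages is flattened into one vector indexed by pairs
    \<open>(i, j)\<close>; the left-edge data depend only on \<open>j\<close>, the bottom-edge data
    only on \<open>i\<close>.\<close>
  define P Q :: "real^('r \<times> 'r)^('r \<times> 'r)"
    where "P = matrix_inv A \<otimes> mat 1" and "Q = mat 1 \<otimes> matrix_inv A"
  define l b :: "3 \<Rightarrow> real^('r \<times> 'r)"
    where "l c = (\<chi> p. zl (snd p) $ c)" and "b c = (\<chi> p. zb (fst p) $ c)" for c
  define v where "v u = (1/dt) *\<^sub>R (P *v (u - l 1) + Q *v (u - b 1))" for u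
  define w where "w u = (1/dx) *\<^sub>R (P *v (u - l 1) - Q *v (u - b 1))" for u
  \<comment> \<open>The right-hand side of the first row times \<open>dt\<^sup>2\<close>, which
    turns 1/dx into \<open>lam * dt\<close> and 1/dt into \<open>dt\<close>.\<close>
  define G where "G u = (lam * dt) *\<^sub>R (P *v (w u - l 3) - Q *v (w u - b 3))
    - dt *\<^sub>R (P *v (v u - l 2) + Q *v (v u - b 2))" for u
  have neg: "M *v (- x) = - (M *v x)" for M :: "real^('r \<times> 'r)^('r \<times> 'r)" and x
    using matrix_vector_mult_diff_distrib[of M 0 x] by simp
  \<comment> \<open>\<open>G\<close> is affine in \<open>u\<close>: all edge data go into the
    constant \<open>G 0\<close>.\<close>
  have G: "G u = G 0 - wave_B lam A *v u" for u
    unfolding wave_B_vector P_def[symmetric] Q_def[symmetric]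
    using assms(1-2)
    by (simp add: assms(3) G_def v_def w_def matrix_vector_right_distrib
        matrix_vector_mult_diff_distrib neg matrix_vector_mult_scaleR vec_eq_iff
        field_simps power2_eq_square)
  obtain u where u: "dt\<^sup>2 *\<^sub>R (\<chi> p. f (u $ p)) = G u"
    using wave_fixpoint[OF assms(6,8,9), of "G 0"] G by metis
  define W :: "3 \<Rightarrow> real^('r \<times> 'r)" where "W c = vector [u, v u, w u] $ c" for c
  define X T :: "3 \<Rightarrow> real^('r \<times> 'r)" where "X c = P *v (W c - l c)" and "T c = Q *v (W c - b c)" for c
  \<comment> \<open>By the mixed-product rule, \<open>A\<close> cancels the
    \<open>matrix_inv A\<close> inside \<open>P\<close> and \<open>Q\<close>.\<close>
  have "(A \<otimes> mat 1) *v X c = W c - l c" "(mat 1 \<otimes> A) *v T c = W c - b c" for c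
    using assms(7) by (simp_all add: X_def T_def P_def Q_def matrix_vector_mul_assoc kronecker_mult
        matrix_inv_right kronecker_mat_1)
  then have stage: "W c = l c + (A \<otimes> mat 1) *v X c" "W c = b c + (mat 1 \<otimes> A) *v T c" for c
    by simp_all
  have f: "f (u $ p) = (X 3 $ p - T 3 $ p) / dx - (T 2 $ p + X 2 $ p) / dt" for p
  proof -
    have "dt\<^sup>2 * f (u $ p) = lam * dt * (X 3 $ p - T 3 $ p) - dt * (T 2 $ p + X 2 $ p)"
      using arg_cong[OF u, of "\<lambda>x. x $ p"] by (simp add: G_def X_def T_def W_def add.commute)
    also have "\<dots> = dt\<^sup>2 * ((X 3 $ p - T 3 $ p) / dx - (T 2 $ p + X 2 $ p) / dt)"
      using assms(1,2) by (simp add: assms(3) right_diff_distrib diff_divide_distrib power2_eq_square)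
    finally show ?thesis
      using assms(1) by simp
  qed
  have W_2: "W 2 $ p = (T 1 $ p + X 1 $ p) / dt" and W_3: "W 3 $ p = (X 1 $ p - T 1 $ p) / dx" for p
    by (simp_all add: W_def X_def T_def v_def w_def)
  define Z' X' T' :: "'r \<Rightarrow> 'r \<Rightarrow> real^3"
    where "Z' i j = (\<chi> c. W c $ (i, j))" and "X' i j = (\<chi> c. X c $ (i, j))"
      and "T' i j = (\<chi> c. T c $ (i, j))" for i j
  have "diamond_stage_equations wave_K wave_L (wave_S V) dt dx A zl zb Z' X' T'"
    unfolding diamond_stage_equations_def
  proof (intro allI conjI)
    fix i j
    show "Z' i j = zl j + (\<Sum>k\<in>UNIV. A $ i $ k *\<^sub>R X' k j)"
      using arg_cong[OF stage(1), of "\<lambda>x. x $ (i, j)"]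
      by (simp add: vec_eq_iff Z'_def X'_def l_def kronecker_mat_1_right_vector)
    show "Z' i j = zb i + (\<Sum>k\<in>UNIV. A $ j $ k *\<^sub>R T' i k)"
      using arg_cong[OF stage(2), of "\<lambda>x. x $ (i, j)"]
      by (simp add: vec_eq_iff Z'_def T'_def b_def kronecker_mat_1_left_vector)
    \<comment> \<open>The three rows are the facts \<open>f\<close>, \<open>W_2\<close> and
      \<open>W_3\<close>, in this order.\<close>
    have "vector [- deriv V (Z' i j $ 1), Z' i j $ 2, - (Z' i j $ 3)]
        = K_tilde dt dx wave_K wave_L *v T' i j + L_tilde dt dx wave_K wave_L *v X' i j"
    proof -
      have "- deriv V (Z' i j $ 1) = f (u $ (i, j))"
        by (simp add: assms(5) Z'_def W_def)
      then show ?thesis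
        by (simp add: vec_eq_iff forall_3 f W_2 W_3 Z'_def X'_def T'_def K_tilde_def L_tilde_def
            wave_K_def wave_L_def matrix_vector_mult_def sum_3 diff_divide_distrib add_divide_distrib)
    qed
    then show "GDERIV (wave_S V) (Z' i j) :>
        K_tilde dt dx wave_K wave_L *v T' i j + L_tilde dt dx wave_K wave_L *v X' i j"
      using GDERIV_wave_S[OF assms(4), of "Z' i j"] by simp
  qed
  then show "\<exists>Z X T. diamond_stage_equations wave_K wave_L (wave_S V) dt dx A zl zb Z X T"
    by blast
qed

end
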